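(* Let $k\ge 1$ be an integer and let $X$ be a finite simple graph in which every odd cycle has length at least $2k+1$, and let $\chi$ be the chromatic number of $X$. Then the number of vertices of $X$ is at least \[ 2\binom{k-1 + \lfloor \frac{\chi-1}{2}\rfloor}{k-1} + \binom{k - 1 + \lfloor \frac{\chi-1}{2}\rfloor}{k} - 1. \]
   Context: The chromatic number of a graph is the minimum number of colors in a proper vertex coloring (adjacent vertices receive different colors). Binomial coefficients $\binom{a}{b}$ with $b>a\ge 0$ are $0$. *)

theory Defs
  imports Complex_Main "Graph_Theory.Arc_Walk"
begin

text \<open>
  Finite simple graphs are the symmetric, loop-free digraphs without parallel arcs of the locale
  \<open>graph\<close>: an edge is a pair of opposite arcs. The closed walk \<open>u, v, u\<close> then counts as a cycle,
  but its length is even; the odd cycles are exactly those of the undirected graph.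
\<close>

definition proper_coloring :: "('a, 'b) pre_digraph \<Rightarrow> ('a \<Rightarrow> 'c) \<Rightarrow> bool" where
  "proper_coloring G c \<longleftrightarrow> (\<forall>u v. u \<rightarrow>\<^bsub>G\<^esub> v \<longrightarrow> c u \<noteq> c v)"

definition colorable :: "('a, 'b) pre_digraph \<Rightarrow> nat \<Rightarrow> bool" where
  "colorable G n \<longleftrightarrow> (\<exists>c :: 'a \<Rightarrow> nat. proper_coloring G c \<and> c ` verts G \<subseteq> {..<n})"

definition chromatic_number :: "('a, 'b) pre_digraph \<Rightarrow> nat" where
  "chromatic_number G = (LEAST n. colorable G n)"

lemma (in graph) colorable_card_verts: "colorable G (card (verts G))"
proof -
  obtain c where c: "bij_betw c (verts G) {0..<card (verts G)}"
    using ex_bij_betw_finite_nat[OF finite_verts] by blast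
  have "c u \<noteq> c v" if "u \<rightarrow>\<^bsub>G\<^esub> v" for u v
  proof -
    have "u \<in> verts G" "v \<in> verts G" "u \<noteq> v"
      using that adj_in_verts adj_not_same by blast+
    then show ?thesis
      using c by (auto simp: bij_betw_def inj_on_def)
  qed
  then show ?thesis
    using c unfolding colorable_def proper_coloring_def
    by (intro exI[of _ c]) (auto simp: bij_betw_def)
qed

lemma (in graph) colorable_chromatic_number: "colorable G (chromatic_number G)"
  unfolding chromatic_number_def by (rule LeastI) (rule colorable_card_verts)

end

theory Submission
  imports Defs
begin

text \<open>
  Balls of radius less than \<open>k\<close> are bipartite, since two walks from the centre whose lengths have
  the same parity cannot end in adjacent vertices. Let \<open>U\<close> be a largest set of vertices inducing
  a bipartite graph and \<open>L\<close> its complement, so that \<open>\<chi>(L) \<ge> \<chi> - 2\<close>. For every vertex \<open>v\<close> and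
  \<open>r < k\<close> the set \<open>(U - B\<^bsub>r+1\<^esub>(v)) \<union> B\<^bsub>r\<^esub>(v)\<close> is again bipartite, hence maximality
  of \<open>U\<close> gives \<open>|U \<inter> B\<^bsub>r+1\<^esub>(v)| \<ge> |B\<^bsub>r\<^esub>(v)|\<close>. If \<open>v\<close> is chosen by induction in \<open>L\<close>, then
  \<open>|B\<^bsub>r+1\<^esub>(v)|\<close> is at least \<open>|B\<^bsub>r\<^esub>(v)|\<close> plus the size of the ball of radius \<open>r + 1\<close> in \<open>L\<close>,
  which is Pascal's recursion. The induction starts with a vertex-critical non-bipartite graph,
  all of whose spheres of radius between \<open>1\<close> and \<open>k\<close> have at least two elements.
\<close>

section \<open>Bipartite and colourable vertex sets, balls in induced subgraphs\<close>

definition bipartite_on :: "('a \<times> 'a) set \<Rightarrow> 'a set \<Rightarrow> bool" where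
  "bipartite_on R S \<longleftrightarrow> (\<exists>c :: 'a \<Rightarrow> bool. \<forall>x\<in>S. \<forall>y\<in>S. (x, y) \<in> R \<longrightarrow> c x \<noteq> c y)"

definition colorable_on :: "('a \<times> 'a) set \<Rightarrow> 'a set \<Rightarrow> nat \<Rightarrow> bool" where
  "colorable_on R S n \<longleftrightarrow>
    (\<exists>c :: 'a \<Rightarrow> nat. (\<forall>x\<in>S. \<forall>y\<in>S. (x, y) \<in> R \<longrightarrow> c x \<noteq> c y) \<and> c ` S \<subseteq> {..<n})"

text \<open>Walks stay in \<open>W\<close>, so distances are those of the induced subgraph. The walk
  of length 0 puts \<open>v\<close> into its ball even when \<open>v\<close> lies outside
  \<open>W\<close>.\<close>

definition ball_in :: "('a \<times> 'a) set \<Rightarrow> 'a set \<Rightarrow> nat \<Rightarrow> 'a \<Rightarrow> 'a set" where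
  "ball_in R W r v = {x. \<exists>i\<le>r. (v, x) \<in> (R \<inter> W \<times> W) ^^ i}"

lemma bipartite_on_empty: "bipartite_on R {}"
  by (simp add: bipartite_on_def)

text \<open>The two classes of \<open>U\<close> receive the fresh colours \<open>n\<close> and
  \<open>n + 1\<close>. Contrapositively, deleting a bipartite set lowers the chromatic number by at
  most two.\<close>

lemma colorable_on_add_bipartite:
  assumes "bipartite_on R U" and "colorable_on R (W - U) n"
  shows "colorable_on R W (n + 2)"
proof -
  obtain b :: "'a \<Rightarrow> bool" where b: "\<And>x y. x \<in> U \<Longrightarrow> y \<in> U \<Longrightarrow> (x, y) \<in> R \<Longrightarrow> b x \<noteq> b y"
    using assms(1) unfolding bipartite_on_def by blast
  obtain c :: "'a \<Rightarrow> nat"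
    where c: "\<And>x y. x \<in> W - U \<Longrightarrow> y \<in> W - U \<Longrightarrow> (x, y) \<in> R \<Longrightarrow> c x \<noteq> c y"
      and cn: "\<And>x. x \<in> W - U \<Longrightarrow> c x < n"
    using assms(2) unfolding colorable_on_def by blast
  define d where "d x = (if x \<in> U then if b x then n else n + 1 else c x)" for x
  have "d x \<noteq> d y" if "x \<in> W" "y \<in> W" "(x, y) \<in> R" for x y
    using that b[of x y] c[of x y] cn[of x] cn[of y] by (auto simp: d_def)
  moreover have "d x < n + 2" if "x \<in> W" for x
    using that cn[of x] by (auto simp: d_def)
  ultimately show ?thesis
    unfolding colorable_on_def by blast
qed

lemma bipartite_on_imp_colorable_on_2:
  assumes "bipartite_on R W"
  shows "colorable_on R W 2"
  using colorable_on_add_bipartite[OF assms, of W 0]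
  by (simp add: colorable_on_def numeral_2_eq_2)

lemma relpow_mono_rel:
  fixes R S :: "('a \<times> 'a) set"
  assumes "R \<subseteq> S"
  shows "R ^^ n \<subseteq> S ^^ n"
  using assms by (induction n) auto

lemma centre_in_ball_in: "v \<in> ball_in R W r v"
  by (auto simp: ball_in_def intro: exI[of _ 0])

lemma ball_in_0: "ball_in R W 0 v = {v}"
  by (auto simp: ball_in_def)

lemma ball_in_mono_radius: "r \<le> s \<Longrightarrow> ball_in R W r v \<subseteq> ball_in R W s v"
  unfolding ball_in_def by (blast intro: order_trans)

lemma ball_in_mono: "L \<subseteq> W \<Longrightarrow> ball_in R L r v \<subseteq> ball_in R W r v"
  unfolding ball_in_def using relpow_mono_rel[of "R \<inter> L \<times> L" "R \<inter> W \<times> W"] by blast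

lemma ball_in_subset: "v \<in> W \<Longrightarrow> ball_in R W r v \<subseteq> W"
proof
  fix x assume "v \<in> W" "x \<in> ball_in R W r v"
  then obtain i where "(v, x) \<in> (R \<inter> W \<times> W) ^^ i"
    by (auto simp: ball_in_def)
  with \<open>v \<in> W\<close> show "x \<in> W"
    by (cases i) auto
qed

lemma ball_in_step:
  assumes "x \<in> ball_in R W r v" "(x, y) \<in> R" "x \<in> W" "y \<in> W"
  shows "y \<in> ball_in R W (Suc r) v"
proof -
  obtain i where "i \<le> r" "(v, x) \<in> (R \<inter> W \<times> W) ^^ i"
    using assms(1) by (auto simp: ball_in_def)
  then have "(v, y) \<in> (R \<inter> W \<times> W) ^^ Suc i" "Suc i \<le> Suc r"
    using assms by auto
  then show ?thesis
    unfolding ball_in_def by blast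
qed

section \<open>Bipartite balls and the exchange argument\<close>

text \<open>Closed walks stand in for cycles because concatenation yields them directly, without any
  check for repeated vertices.\<close>

locale large_odd_girth =
  fixes R :: "('a \<times> 'a) set" and k :: nat
  assumes sym_R: "sym R"
    and no_short_odd_closed_walk: "odd n \<Longrightarrow> n < 2 * k \<Longrightarrow> (x, x) \<notin> R ^^ n"
begin

lemma relpow_sym: "(x, y) \<in> R ^^ n \<Longrightarrow> (y, x) \<in> R ^^ n"
proof (induction n arbitrary: y)
  case (Suc n)
  then obtain z where "(x, z) \<in> R ^^ n" "(z, y) \<in> R"
    by auto
  then have "(y, z) \<in> R" "(z, x) \<in> R ^^ n"
    using sym_R Suc.IH by (auto dest: symD)
  then show ?case
    by (rule relpow_Suc_I2)
qed simp

text \<open>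
  The colour is the parity of the distance to \<open>v\<close>. Letting \<open>y\<close> range over the larger ball is
  free, because distances \<open>r\<close> and \<open>r + 1\<close> differ in parity; the balls of radius \<open>k\<close> need it.
\<close>

lemma ball_parity_coloring:
  assumes "r < k"
  shows "\<exists>c :: 'a \<Rightarrow> bool. \<forall>x\<in>ball_in R W r v. \<forall>y\<in>ball_in R W (Suc r) v.
    (x, y) \<in> R \<longrightarrow> c x \<noteq> c y"
proof -
  define d where "d x = (LEAST i. (v, x) \<in> (R \<inter> W \<times> W) ^^ i)" for x
  have d: "d x \<le> s \<and> (v, x) \<in> R ^^ d x" if x: "x \<in> ball_in R W s v" for x s
  proof -
    obtain i where i: "i \<le> s" "(v, x) \<in> (R \<inter> W \<times> W) ^^ i"
      using x by (auto simp: ball_in_def)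
    have "(v, x) \<in> (R \<inter> W \<times> W) ^^ d x" "d x \<le> i"
      using i(2) unfolding d_def by (auto intro: LeastI Least_le)
    then show ?thesis
      using i(1) relpow_mono_rel[of "R \<inter> W \<times> W" R "d x"] by auto
  qed
  have "even (d x) \<noteq> even (d y)"
    if x: "x \<in> ball_in R W r v" and y: "y \<in> ball_in R W (Suc r) v" and xy: "(x, y) \<in> R" for x y
  proof
    assume par: "even (d x) = even (d y)"
    have le: "d x \<le> r" "d y \<le> Suc r"
      using d[OF x] d[OF y] by auto
    \<comment> \<open>Equal parity excludes the extreme sum, so the closed walk from
      \<open>v\<close> to \<open>x\<close>, across the edge and back from \<open>y\<close> has odd
      length at most \<open>2 * r + 1\<close>, below \<open>2 * k\<close>.\<close>
    have "d x + d y \<noteq> Suc (2 * r)"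
      using par by (metis even_add even_Suc even_mult_iff even_numeral)
    then have "d x + d y \<le> 2 * r"
      using le by linarith
    then have short: "d x + 1 + d y < 2 * k" "odd (d x + 1 + d y)"
      using par assms by auto
    have "(v, y) \<in> R ^^ (d x + 1)"
      using d[OF x] xy by auto
    moreover have "(y, v) \<in> R ^^ d y"
      using d[OF y] relpow_sym by blast
    ultimately have "(v, v) \<in> R ^^ (d x + 1 + d y)"
      unfolding relpow_add by blast
    then show False
      using no_short_odd_closed_walk short by blast
  qed
  then show ?thesis
    by (intro exI[of _ "\<lambda>x. even (d x)"]) blast
qed

text \<open>Neighbours in \<open>U\<close> of the inner ball lie in the larger ball. Once that is
  removed from \<open>U\<close>, no edge joins the two pieces, and each keeps its own
  colouring.\<close>

lemma bipartite_on_swap_ball: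
  assumes "bipartite_on R U" "U \<subseteq> W" "v \<in> W" "r < k"
  shows "bipartite_on R ((U - ball_in R W (Suc r) v) \<union> ball_in R W r v)"
proof -
  obtain b :: "'a \<Rightarrow> bool" where b: "\<And>x y. x \<in> U \<Longrightarrow> y \<in> U \<Longrightarrow> (x, y) \<in> R \<Longrightarrow> b x \<noteq> b y"
    using assms(1) unfolding bipartite_on_def by blast
  obtain c :: "'a \<Rightarrow> bool"
    where c: "\<And>x y. x \<in> ball_in R W r v \<Longrightarrow> y \<in> ball_in R W (Suc r) v \<Longrightarrow>
      (x, y) \<in> R \<Longrightarrow> c x \<noteq> c y"
    using ball_parity_coloring[OF assms(4), of W v] by blast
  have sub: "ball_in R W r v \<subseteq> ball_in R W (Suc r) v"
    by (rule ball_in_mono_radius) simp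
  have far: "y \<in> ball_in R W (Suc r) v" if "x \<in> ball_in R W r v" "y \<in> U" "(x, y) \<in> R" for x y
    using ball_in_step[OF that(1,3)] ball_in_subset[OF assms(3)] that assms(2) by blast
  define d where "d x = (if x \<in> ball_in R W r v then c x else b x)" for x
  have "d x \<noteq> d y"
    if x: "x \<in> (U - ball_in R W (Suc r) v) \<union> ball_in R W r v"
      and y: "y \<in> (U - ball_in R W (Suc r) v) \<union> ball_in R W r v" and xy: "(x, y) \<in> R" for x y
    using x y xy b[of x y] c[of x y] far[of x y] far[of y x] sub symD[OF sym_R xy]
    by (auto simp: d_def)
  then show ?thesis
    unfolding bipartite_on_def by blast
qed

lemma card_ball_le_max_bipartite:
  assumes "finite W" "U \<subseteq> W" "bipartite_on R U" "v \<in> W" "r < k"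
    and max: "\<And>S. S \<subseteq> W \<Longrightarrow> bipartite_on R S \<Longrightarrow> card S \<le> card U"
  shows "card (ball_in R W r v) \<le> card (U \<inter> ball_in R W (Suc r) v)"
proof -
  let ?A = "ball_in R W r v" and ?B = "ball_in R W (Suc r) v"
  have fin: "finite U" "finite ?A"
    using assms ball_in_subset[of v W R r] by (auto intro: finite_subset)
  have "?A \<subseteq> ?B"
    by (rule ball_in_mono_radius) simp
  then have "card ((U - ?B) \<union> ?A) = card (U - ?B) + card ?A"
    using fin by (intro card_Un_disjoint) auto
  moreover have "card ((U - ?B) \<union> ?A) \<le> card U"
    using assms ball_in_subset[of v W R r] by (intro max bipartite_on_swap_ball) auto
  moreover have "card U = card (U - ?B) + card (U \<inter> ?B)"
    using card_Diff_subset_Int[of U ?B] card_mono[of U "U \<inter> ?B"] fin by auto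
  ultimately show ?thesis
    by linarith
qed

section \<open>Vertex-critical non-bipartite sets\<close>

text \<open>If the sphere had at most one vertex \<open>w\<close>, every edge of \<open>W\<close>
  leaving the inner ball would end in \<open>w\<close>. The ball and its complement are both
  bipartite, so two-colourings matched at \<open>w\<close> would combine to one of
  \<open>W\<close>.\<close>

lemma sphere_card_ge_2:
  assumes "finite W" "v \<in> W" "r < k" and nb: "\<not> bipartite_on R W"
    and crit: "\<And>S. S \<subset> W \<Longrightarrow> bipartite_on R S"
  shows "card (ball_in R W r v) + 2 \<le> card (ball_in R W (Suc r) v)"
proof (rule ccontr)
  let ?A = "ball_in R W r v" and ?B = "ball_in R W (Suc r) v"
  assume small: "\<not> ?thesis"
  have AB: "?A \<subseteq> ?B"
    by (rule ball_in_mono_radius) simp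
  have BW: "?B \<subseteq> W"
    by (rule ball_in_subset) fact
  have fin: "finite ?B"
    using BW assms(1) by (rule finite_subset)
  have "card (?B - ?A) \<le> 1"
    using small AB fin by (simp add: card_Diff_subset finite_subset)
  then have "\<forall>x\<in>?B - ?A. \<forall>y\<in>?B - ?A. x = y"
    using fin by (subst card_le_Suc0_iff_eq[symmetric]) auto
  then obtain w where w: "?B - ?A \<subseteq> {w}"
    by blast
  obtain c :: "'a \<Rightarrow> bool" where c: "\<And>x y. x \<in> ?A \<Longrightarrow> y \<in> ?B \<Longrightarrow> (x, y) \<in> R \<Longrightarrow> c x \<noteq> c y"
    using ball_parity_coloring[OF assms(3), of W v] by blast
  have "W - ?A \<subset> W"
    using centre_in_ball_in assms(2) by fastforce
  then have "bipartite_on R (W - ?A)"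
    by (rule crit)
  then obtain b :: "'a \<Rightarrow> bool"
    where b: "\<And>x y. x \<in> W - ?A \<Longrightarrow> y \<in> W - ?A \<Longrightarrow> (x, y) \<in> R \<Longrightarrow> b x \<noteq> b y"
    unfolding bipartite_on_def by blast
  \<comment> \<open>Outside the ball, \<open>b\<close> is negated exactly when it disagrees with
    \<open>c\<close> at \<open>w\<close>. If the sphere is empty, \<open>w\<close> is arbitrary and
    no edge crosses.\<close>
  define d where "d x = (if x \<in> ?A then c x else b x = (b w = c w))" for x
  have cross: "d x \<noteq> d y" if "x \<in> ?A" "y \<in> W - ?A" "(x, y) \<in> R" for x y
  proof -
    have "y \<in> ?B"
      using ball_in_step[OF that(1,3)] that AB BW by blast
    then have "y = w"
      using that(2) w by blast
    then show ?thesis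
      using that c[OF that(1) \<open>y \<in> ?B\<close> that(3)] by (auto simp: d_def)
  qed
  have "d x \<noteq> d y" if "x \<in> W" "y \<in> W" "(x, y) \<in> R" for x y
  proof -
    have yx: "(y, x) \<in> R"
      using sym_R that(3) by (rule symD)
    consider "x \<in> ?A" "y \<in> ?A" | "x \<in> ?A" "y \<notin> ?A" | "x \<notin> ?A" "y \<in> ?A" | "x \<notin> ?A" "y \<notin> ?A"
      by blast
    then show ?thesis
    proof cases
      case 1
      then show ?thesis
        using c[of x y] AB that by (auto simp: d_def)
    next
      case 2
      then show ?thesis
        using cross[of x y] that by auto
    next
      case 3
      then show ?thesis
        using cross[of y x] that yx by auto
    next
      case 4
      then show ?thesis
        using b[of x y] that by (auto simp: d_def)
    qed
  qed
  then have "bipartite_on R W"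
    unfolding bipartite_on_def by blast
  with nb show False
    by contradiction
qed

lemma nonbipartite_ball_card:
  assumes "finite W" "\<not> bipartite_on R W"
  shows "\<exists>v\<in>W. \<forall>r\<le>k. 2 * r + 1 \<le> card (ball_in R W r v)"
proof -
  define P where "P S \<longleftrightarrow> S \<subseteq> W \<and> \<not> bipartite_on R S" for S
  have "P W"
    using assms(2) by (simp add: P_def)
  \<comment> \<open>Minimum cardinality makes \<open>M\<close> vertex-critical, so each radius adds
    two vertices to its balls; these lie in the balls of \<open>W\<close>.\<close>
  then obtain M where M: "P M" and least: "\<And>S. P S \<Longrightarrow> card M \<le> card S"
    using ex_has_least_nat[of P W card] by blast
  have MW: "M \<subseteq> W" and nb: "\<not> bipartite_on R M"
    using M by (auto simp: P_def)
  have finM: "finite M"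
    using MW assms(1) by (rule finite_subset)
  have crit: "bipartite_on R S" if "S \<subset> M" for S
    using least[of S] psubset_card_mono[OF finM that] that MW by (auto simp: P_def)
  obtain v where v: "v \<in> M"
    using nb bipartite_on_empty[of R] by (cases "M = {}") auto
  have "2 * r + 1 \<le> card (ball_in R M r v)" if "r \<le> k" for r
    using that
  proof (induction r)
    case 0
    then show ?case
      by (simp add: ball_in_0)
  next
    case (Suc r)
    then show ?case
      using sphere_card_ge_2[OF finM v _ nb crit, of r] by simp
  qed
  moreover have "card (ball_in R M r v) \<le> card (ball_in R W r v)" for r
    using v MW assms(1) ball_in_subset[of v W R r]
    by (intro card_mono ball_in_mono) (auto intro: finite_subset)
  ultimately show ?thesis
    using v MW by (meson order_trans subsetD)
qed

section \<open>Induction on the number of colours\<close>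

text \<open>Write \<open>f r s\<close> for the bound. Then \<open>f r 0 = 2 * r + 1\<close>,
  \<open>f 0 s = 1\<close>, and Pascal's rule gives
  \<open>f (Suc r) (Suc s) = f r (Suc s) + f (Suc r) s\<close>. The centre is chosen before the
  radius because the inner induction compares consecutive balls about one vertex.\<close>

lemma ball_card_of_not_colorable:
  assumes "finite W" "\<not> colorable_on R W (2 * Suc s)"
  shows "\<exists>v\<in>W. \<forall>r\<le>k. (Suc (r + s) choose Suc s) + (r + s choose Suc s) \<le> card (ball_in R W r v)"
  using assms
proof (induction s arbitrary: W)
  case 0
  then have "\<not> bipartite_on R W"
    using bipartite_on_imp_colorable_on_2 by fastforce
  then show ?case
    using nonbipartite_ball_card[OF 0(1)] by (simp add: mult_2)
next
  case (Suc s)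
  have "\<exists>U. (U \<subseteq> W \<and> bipartite_on R U) \<and> (\<forall>S. S \<subseteq> W \<and> bipartite_on R S \<longrightarrow> card S \<le> card U)"
  proof (rule ex_has_greatest_nat[where b = "Suc (card W)"])
    show "{} \<subseteq> W \<and> bipartite_on R {}"
      by (simp add: bipartite_on_empty)
  qed (use Suc.prems(1) in \<open>auto simp: less_Suc_eq_le intro: card_mono\<close>)
  then obtain U where U: "U \<subseteq> W" "bipartite_on R U"
    and max: "\<And>S. S \<subseteq> W \<Longrightarrow> bipartite_on R S \<Longrightarrow> card S \<le> card U"
    by blast
  define L where "L = W - U"
  have "\<not> colorable_on R L (2 * Suc s)"
    using colorable_on_add_bipartite[OF U(2), of W "2 * Suc s"] Suc.prems(2) by (auto simp: L_def)
  then obtain v where v: "v \<in> L"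
    and IH: "\<And>r. r \<le> k \<Longrightarrow>
      (Suc (r + s) choose Suc s) + (r + s choose Suc s) \<le> card (ball_in R L r v)"
    using Suc.IH[of L] Suc.prems(1) by (auto simp: L_def)
  have vW: "v \<in> W"
    using v by (simp add: L_def)
  have "(Suc (r + Suc s) choose Suc (Suc s)) + (r + Suc s choose Suc (Suc s))
      \<le> card (ball_in R W r v)" if "r \<le> k" for r
    using that
  proof (induction r)
    case 0
    then show ?case
      by (simp add: ball_in_0)
  next
    case (Suc r)
    let ?B = "ball_in R W (Suc r) v"
    have "finite ?B"
      using ball_in_subset[OF vW] \<open>finite W\<close> by (rule finite_subset)
    moreover have "ball_in R L (Suc r) v \<subseteq> ?B"
      by (rule ball_in_mono) (auto simp: L_def)
    moreover have "ball_in R L (Suc r) v \<subseteq> L"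
      using v by (rule ball_in_subset)
    \<comment> \<open>\<open>U\<close> and \<open>L\<close> are disjoint: the share in
      \<open>L\<close> is bounded by the outer induction, the share in \<open>U\<close> by the
      exchange argument for balls of \<open>W\<close>.\<close>
    ultimately have "card (U \<inter> ?B) + card (ball_in R L (Suc r) v) \<le> card ?B"
      by (subst card_Un_disjoint[symmetric]) (auto simp: L_def intro: finite_subset card_mono)
    moreover have "card (ball_in R W r v) \<le> card (U \<inter> ?B)"
      using Suc.prems by (intro card_ball_le_max_bipartite[OF \<open>finite W\<close> U vW _ max]) auto
    ultimately show ?case
      using IH[OF Suc.prems] Suc by simp
  qed
  then show ?case
    using vW by blast
qed

end

section \<open>From odd closed walks to odd cycles\<close>

context wf_digraph
begin

lemma relpow_arcs_ends_imp_awalk: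
  assumes "(u, v) \<in> arcs_ends G ^^ n" "u \<in> verts G"
  shows "\<exists>p. awalk u p v \<and> length p = n"
  using assms
proof (induction n arbitrary: v)
  case 0
  then show ?case
    by (auto simp: awalk_Nil_iff intro: exI[of _ "[]"])
next
  case (Suc n)
  then obtain w p where "awalk u p w" "length p = n" "(w, v) \<in> arcs_ends G"
    by (auto elim!: relpow_Suc_E) blast
  moreover from this obtain e where "awalk w [e] v"
    by (auto simp: arcs_ends_def arc_to_ends_def awalk_simps intro: head_in_verts)
  ultimately show ?case
    by (intro exI[of _ "p @ [e]"]) auto
qed

text \<open>At a repeated vertex the walk splits into two shorter closed walks, and one of them is
  odd because their lengths have an odd sum.\<close>

lemma odd_closed_awalk_imp_odd_cycle:
  assumes "awalk u p u" "odd (length p)"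
  shows "\<exists>q. cycle q \<and> odd (length q) \<and> length q \<le> length p"
  using assms
proof (induction "length p" arbitrary: u p rule: less_induct)
  case less
  show ?case
  proof (cases "distinct (tl (awalk_verts u p))")
    case True
    then show ?thesis
      using less.prems unfolding cycle_def by (intro exI[of _ p]) auto
  next
    case False
    \<comment> \<open>\<open>cycle\<close> asks for distinctness only of the tail of the vertex
      list, so the repetition occurs in the walk \<open>es\<close> after the first arc. Keeping
      \<open>e\<close> apart also makes \<open>r\<close> strictly shorter than
      \<open>p\<close>.\<close>
    obtain e es where p: "p = e # es"
      using less.prems(2) by (cases p) auto
    have e: "awalk u [e] (head G e)" and es: "awalk (head G e) es u"
      using less.prems(1) by (auto simp: p awalk_simps)
    have "\<not> distinct (awalk_verts (head G e) es)"
      using False by (simp add: p)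
    then obtain q r s w where qrs: "es = q @ r @ s" "awalk (head G e) q w" "awalk w r w"
        "awalk w s u" "closed_w r"
      using awalk_cyc_decompE'[OF es] by metis
    show ?thesis
    proof (cases "odd (length r)")
      case True
      have "length r < length p"
        by (simp add: p qrs(1))
      then show ?thesis
        using less.hyps[OF _ qrs(3) True] by fastforce
    next
      case False
      have "awalk u ([e] @ q @ s) u"
        using e qrs by (metis awalk_appendI)
      moreover have "odd (length ([e] @ q @ s))"
        using False less.prems(2) by (simp add: p qrs(1))
      moreover have "length ([e] @ q @ s) < length p"
        using qrs(5) by (simp add: p qrs(1) closed_w_def)
      ultimately show ?thesis
        using less.hyps[of "[e] @ q @ s" u] by fastforce
    qed
  qed
qed

end

lemma (in graph) large_odd_girth_arcs_ends:
  assumes "\<And>p. cycle p \<Longrightarrow> odd (length p) \<Longrightarrow> length p \<ge> 2 * k + 1"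
  shows "large_odd_girth (arcs_ends G) k"
proof
  show "sym (arcs_ends G)"
    using sym_arcs by (simp add: symmetric_def)
next
  fix n x
  assume n: "odd n" "n < 2 * k"
  show "(x, x) \<notin> arcs_ends G ^^ n"
  proof
    assume walk: "(x, x) \<in> arcs_ends G ^^ n"
    obtain m where "n = Suc m"
      using n(1) by (cases n) auto
    then have "x \<in> verts G"
      using walk adj_in_verts(2) by auto
    then obtain p where "awalk x p x" "length p = n"
      using relpow_arcs_ends_imp_awalk[OF walk] by blast
    then show False
      using odd_closed_awalk_imp_odd_cycle[of x p] assms n by fastforce
  qed
qed

lemma (in graph) colorable_of_colorable_on:
  assumes "colorable_on (arcs_ends G) (verts G) n"
  shows "colorable G n"
  using assms unfolding colorable_on_def colorable_def proper_coloring_def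
  by (meson adj_in_verts)

section \<open>The binomial bound, by the value of the chromatic number\<close>

theorem mainTheorem1:
  fixes X :: "('a, 'b) pre_digraph" and k :: nat
  assumes "k \<ge> 1"
    and "graph X"
    and "\<And>p. pre_digraph.cycle X p \<Longrightarrow> odd (length p) \<Longrightarrow> length p \<ge> 2 * k + 1"
  shows "real (card (verts X)) \<ge>
      2 * (real_of_int (int k - 1 + \<lfloor>(real (chromatic_number X) - 1) / 2\<rfloor>) gchoose (k - 1))
      + (real_of_int (int k - 1 + \<lfloor>(real (chromatic_number X) - 1) / 2\<rfloor>) gchoose k) - 1"
proof -
  interpret graph X by fact
  interpret large_odd_girth "arcs_ends X" k
    using assms(3) by (rule large_odd_girth_arcs_ends)
  let ?\<chi> = "chromatic_number X"
  obtain j where j: "k = Suc j"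
    using assms(1) by (cases k) auto
  have fl: "\<lfloor>(real ?\<chi> - 1) / 2\<rfloor> = (int ?\<chi> - 1) div 2"
    using floor_divide_of_int_eq[of "int ?\<chi> - 1" 2] by simp
  consider "?\<chi> = 0" | "?\<chi> = 1 \<or> ?\<chi> = 2" | "?\<chi> \<ge> 3"
    by linarith
  then show ?thesis
  proof cases
    case 1
    \<comment> \<open>The floor is -1. For \<open>k = 1\<close> the generalised binomials are 1 and
      -1 and the bound is 0; for larger \<open>k\<close> both vanish and it is -1.\<close>
    have t: "int k - 1 + \<lfloor>(real ?\<chi> - 1) / 2\<rfloor> = int j - 1"
      using fl 1 j by simp
    show ?thesis
    proof (cases j)
      case 0
      then show ?thesis
        unfolding t by (simp add: j)
    next
      case (Suc i)
      have "real_of_int (int j - 1) = real i"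
        by (simp add: Suc)
      then show ?thesis
        unfolding t by (simp add: j Suc binomial_eq_0 flip: binomial_gbinomial)
    qed
  next
    case 2
    \<comment> \<open>The floor is 0 and the bound is 1, so it is enough that the graph has a
      vertex.\<close>
    have t: "int k - 1 + \<lfloor>(real ?\<chi> - 1) / 2\<rfloor> = int j"
      using fl 2 j by auto
    have "card (verts X) \<noteq> 0"
    proof
      assume "card (verts X) = 0"
      then have "?\<chi> \<le> 0"
        unfolding chromatic_number_def using colorable_card_verts by (intro Least_le) simp
      then show False
        using 2 by auto
    qed
    then have "1 \<le> real (card (verts X))"
      by linarith
    moreover have "2 * (real_of_int (int j) gchoose (k - 1)) + (real_of_int (int j) gchoose k) = 2"
      by (simp add: j binomial_eq_0 flip: binomial_gbinomial)
    ultimately show ?thesis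
      unfolding t by linarith
  next
    case 3
    \<comment> \<open>The shift makes the floor equal to \<open>Suc s\<close>, and
      \<open>2 * Suc s\<close> is the largest even number below the chromatic number.\<close>
    define s where "s = (?\<chi> - 1) div 2 - 1"
    have s: "(?\<chi> - 1) div 2 = Suc s" "2 * Suc s < ?\<chi>"
      using 3 unfolding s_def by presburger+
    have "(int ?\<chi> - 1) div 2 = int (Suc s)"
      using s(1) 3 by (metis (no_types, lifting) int_ops(2) of_nat_diff of_nat_numeral
          one_le_numeral order_trans zdiv_int)
    then have t: "real_of_int (int k - 1 + \<lfloor>(real ?\<chi> - 1) / 2\<rfloor>) = real (Suc (j + s))"
      using fl j by simp
    have "\<not> colorable X (2 * Suc s)"
      using s(2) not_less_Least unfolding chromatic_number_def by blast
    then obtain v where "v \<in> verts X"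
      and v: "(Suc (k + s) choose Suc s) + (k + s choose Suc s)
        \<le> card (ball_in (arcs_ends X) (verts X) k v)"
      using ball_card_of_not_colorable[OF finite_verts, of s] colorable_of_colorable_on by blast
    have "card (ball_in (arcs_ends X) (verts X) k v) \<le> card (verts X)"
      using \<open>v \<in> verts X\<close> by (intro card_mono ball_in_subset) auto
    \<comment> \<open>Symmetry and Pascal's rule move the lower indices from \<open>Suc s\<close> to
      \<open>k - 1\<close> and \<open>k\<close>.\<close>
    moreover have "(Suc (k + s) choose Suc s) = (Suc (j + s) choose j) + (Suc (j + s) choose Suc j)"
      using binomial_symmetric[of "Suc s" "Suc (k + s)"] by (simp add: j)
    moreover have "(k + s choose Suc s) = (Suc (j + s) choose j)"
      using binomial_symmetric[of "Suc s" "Suc (j + s)"] by (simp add: j)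
    ultimately have "2 * (Suc (j + s) choose j) + (Suc (j + s) choose Suc j) \<le> card (verts X)"
      using v by linarith
    then have "2 * real (Suc (j + s) choose j) + real (Suc (j + s) choose Suc j)
        \<le> real (card (verts X))"
      by linarith
    then show ?thesis
      unfolding t unfolding j binomial_gbinomial diff_Suc_1 by linarith
  qed
qed

end
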